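(* Let $d\ge 1$, let $\alpha_1,\dots,\alpha_d\ge 0$ with $\sum_{j=1}^d\alpha_j=1$, let $n\ge 1$, and let $S_n=s_1s_2\cdots s_n$ be a random string of length $n$ on the alphabet $[d]=\{1,\dots,d\}$ whose letters are independent with $\Pr[s_i=j]=\alpha_j$ for all $i\in[n]$, $j\in[d]$. Let $M$ be the $d\times d$ matrix with $M_{jj}=1$ for all $j$ and $M_{jk}=\alpha_j$ for all $j\ne k$, i.e. $$M=\begin{bmatrix}1&\alpha_1&\alpha_1&\dots&\alpha_1\\ \alpha_2&1&\alpha_2&\dots&\alpha_2\\ \alpha_3&\alpha_3&1&\dots&\alpha_3\\ \vdots&\vdots&\vdots&\ddots&\vdots\\ \alpha_d&\alpha_d&\alpha_d&\dots&1\end{bmatrix}.$$ Then $$E[\phi(S_n)]=\begin{bmatrix}1&1&\cdots&1\end{bmatrix}\left(\sum_{i=0}^{n-1}M^i\right)\begin{bmatrix}\alpha_1\\ \alpha_2\\ \vdots\\ \alpha_d\end{bmatrix},$$ where $M^0$ is the identity matrix.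
   Context: A string $B$ of length $m$ with $1\le m\le n$ is a subsequence of a string $A=a_1a_2\cdots a_n$ if there are indices $i_1<i_2<\dots<i_m$ with $B=a_{i_1}a_{i_2}\cdots a_{i_m}$. For a string $T$, $\phi(T)$ denotes the number of distinct strings that are subsequences of $T$; the empty string is not counted as a subsequence. *)

theory Defs
  imports "HOL-Probability.Probability" "HOL-Library.Sublist"
begin

definition phi :: "'a list \<Rightarrow> nat" where
  "phi T = card {B. B \<noteq> [] \<and> subseq B T}"

definition letter_matrix :: "real ^ 'd \<Rightarrow> real ^ 'd ^ 'd" where
  "letter_matrix \<alpha> = (\<chi> j k. if j = k then 1 else \<alpha> $ j)"

primrec matrix_pow :: "real ^ 'd ^ 'd \<Rightarrow> nat \<Rightarrow> real ^ 'd ^ 'd" where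
  "matrix_pow A 0 = mat 1"
| "matrix_pow A (Suc i) = A ** matrix_pow A i"

text \<open>
  The alphabet is an arbitrary finite type \<open>'d\<close>, whose cardinality plays the role of the
  number of letters; the letters also index vectors and matrices.  The letters of the
  string are random variables \<open>s 1, \<dots>, s n\<close> on a probability space \<open>P\<close>.
\<close>
definition random_string :: "(nat \<Rightarrow> 'w \<Rightarrow> 'd) \<Rightarrow> nat \<Rightarrow> 'w \<Rightarrow> 'd list" where
  "random_string s n \<omega> = map (\<lambda>i. s i \<omega>) [1..<Suc n]"

end

theory Submission
  imports Defs
begin

text \<open>
  Split the nonempty subsequences of a string by their first letter, and let
  \<open>v\<^sub>j(T)\<close> be the number of distinct ones of \<open>T\<close> that begin with \<open>j\<close>.  A subsequence of \<open>x # T\<close>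
  beginning with \<open>j \<noteq> x\<close> already lies in \<open>T\<close>, while those beginning with \<open>x\<close> are obtained by
  putting \<open>x\<close> before an arbitrary, possibly empty, subsequence of \<open>T\<close>; so \<open>v\<^sub>j(x # T) = v\<^sub>j(T)\<close> in
  the first case and \<open>v\<^sub>x(x # T) = 1 + \<Sum>\<^sub>k v\<^sub>k(T)\<close> in the second
  (\<open>count_starting_with_Cons\<close>).

  If \<open>x\<close> is random and independent of \<open>T\<close>, averaging gives
  \<open>E v\<^sub>j(x # T) = (1 - \<alpha>\<^sub>j) E v\<^sub>j(T) + \<alpha>\<^sub>j (1 + \<Sum>\<^sub>k E v\<^sub>k(T))
    = \<alpha>\<^sub>j + (E v\<^sub>j(T) + \<alpha>\<^sub>j \<Sum>\<^sub>k\<^sub>\<noteq>\<^sub>j E v\<^sub>k(T))\<close>,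
  which is the affine recursion \<open>u \<mapsto> \<alpha> + M u\<close> for the vector of mean counts.  Started at \<open>0\<close>
  (the empty string) and iterated \<open>n\<close> times it yields \<open>(\<Sum>i<n. M\<^sup>i) \<alpha>\<close>, whose entries sum to
  \<open>E \<phi>\<close>.

  The averaging is carried out on finite sums over words (\<open>word_mean\<close>), where conditioning on
  the first letter is a rearrangement of a sum.  Independence is used only once, to
  identify the expectation over the probability space with such a sum
  (\<open>expectation_random_string\<close>).
\<close>

section \<open>Counting subsequences by their first letter\<close>

definition count_starting_with :: "'a \<Rightarrow> 'a list \<Rightarrow> nat" where
  "count_starting_with j T = card {B. subseq (j # B) T}"

lemma finite_subseqs: "finite {B. subseq B T}"
  by (simp flip: set_subseqs_eq)

lemma finite_subseqs_starting_with: "finite {B. subseq (j # B) T}"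
  by (rule finite_subset[OF _ finite_subseqs[of T]]) (auto dest: subseq_Cons')

lemma phi_eq_sum_count_starting_with:
  fixes T :: "'d::finite list"
  shows "phi T = (\<Sum>j\<in>UNIV. count_starting_with j T)"
proof -
  have "{B. B \<noteq> [] \<and> subseq B T} = (\<Union>j\<in>UNIV. (#) j ` {B. subseq (j # B) T})"
    by (auto simp: neq_Nil_conv)
  then have "phi T = card (\<Union>j\<in>UNIV. (#) j ` {B. subseq (j # B) T})"
    by (simp add: phi_def)
  also have "\<dots> = (\<Sum>j\<in>UNIV. card ((#) j ` {B. subseq (j # B) T}))"
    by (rule card_UN_disjoint) (auto simp: finite_subseqs_starting_with)
  also have "\<dots> = (\<Sum>j\<in>UNIV. count_starting_with j T)"
    by (simp add: count_starting_with_def card_image)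
  finally show ?thesis .
qed

lemma card_subseqs: "card {B. subseq B T} = Suc (phi T)"
proof -
  have "{B. subseq B T} = insert [] {B. B \<noteq> [] \<and> subseq B T}"
    by auto
  moreover have "finite {B. B \<noteq> [] \<and> subseq B T}"
    by (rule finite_subset[OF _ finite_subseqs[of T]]) auto
  ultimately show ?thesis
    by (simp add: phi_def)
qed

lemma count_starting_with_Nil [simp]: "count_starting_with j [] = 0"
  by (simp add: count_starting_with_def)

text \<open>
  Greedy matching: an occurrence beginning with \<open>x\<close> may be assumed to use the leading \<open>x\<close>,
  and one beginning with another letter must skip it.
\<close>
lemma count_starting_with_Cons:
  "count_starting_with j (x # T) = (if j = x then Suc (phi T) else count_starting_with j T)"
  by (simp add: count_starting_with_def flip: card_subseqs)

section \<open>Averages over words of fixed length\<close>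

definition word_mean :: "real ^ 'd \<Rightarrow> nat \<Rightarrow> ('d::finite list \<Rightarrow> real) \<Rightarrow> real" where
  "word_mean \<alpha> n f = (\<Sum>w | length w = n. prod_list (map (($) \<alpha>) w) * f w)"

lemma finite_words_length: "finite {w :: 'd::finite list. length w = n}"
  using finite_lists_length_eq[of "UNIV :: 'd set" n] by simp

lemma word_mean_0 [simp]: "word_mean \<alpha> 0 f = f []"
  by (simp add: word_mean_def)

text \<open>Conditioning on the first letter.\<close>
lemma word_mean_Suc:
  "word_mean \<alpha> (Suc n) f = (\<Sum>x\<in>UNIV. \<alpha> $ x * word_mean \<alpha> n (\<lambda>w. f (x # w)))"
proof -
  let ?c = "\<lambda>(x, w). x # w"
  have words: "{w :: 'a list. length w = Suc n} = ?c ` (UNIV \<times> {w. length w = n})"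
    by (auto simp: length_Suc_conv image_iff)
  have inj: "inj_on ?c (UNIV \<times> {w :: 'a list. length w = n})"
    by (auto simp: inj_on_def)
  show ?thesis
    unfolding word_mean_def words sum.reindex[OF inj]
    by (simp add: sum.cartesian_product sum_distrib_left case_prod_beta mult_ac)
qed

lemma word_mean_add: "word_mean \<alpha> n (\<lambda>w. f w + g w) = word_mean \<alpha> n f + word_mean \<alpha> n g"
  by (simp add: word_mean_def algebra_simps sum.distrib)

lemma word_mean_sum: "word_mean \<alpha> n (\<lambda>w. \<Sum>k\<in>K. f k w) = (\<Sum>k\<in>K. word_mean \<alpha> n (f k))"
  unfolding word_mean_def by (subst sum.swap) (simp add: sum_distrib_left)

lemma word_mean_1:
  assumes "(\<Sum>j\<in>UNIV. \<alpha> $ j) = 1"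
  shows "word_mean \<alpha> n (\<lambda>_. 1) = 1"
  by (induction n) (simp_all add: word_mean_Suc assms)

section \<open>The mean counts satisfy an affine recursion\<close>

lemma sum_matrix_pow_Suc:
  "(\<Sum>i<Suc n. matrix_pow A i) = mat 1 + A ** (\<Sum>i<n. matrix_pow A i)"
proof (induction n)
  case 0
  then show ?case by simp
next
  case (Suc n)
  have "(\<Sum>i<Suc (Suc n). matrix_pow A i)
      = (mat 1 + A ** (\<Sum>i<n. matrix_pow A i)) + A ** matrix_pow A n"
    unfolding sum.lessThan_Suc[of _ "Suc n"] Suc.IH by simp
  also have "\<dots> = mat 1 + A ** (\<Sum>i<Suc n. matrix_pow A i)"
    unfolding sum.lessThan_Suc[of _ n] by (simp only: matrix_add_ldistrib add.assoc)
  finally show ?case .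
qed

lemma letter_matrix_mult_vector:
  "(letter_matrix \<alpha> *v u) $ j = (1 - \<alpha> $ j) * u $ j + \<alpha> $ j * (\<Sum>k\<in>UNIV. u $ k)"
proof -
  have "(letter_matrix \<alpha> *v u) $ j
      = u $ j + \<alpha> $ j * (\<Sum>k\<in>UNIV - {j}. u $ k)"
    by (simp add: letter_matrix_def matrix_vector_mult_def sum.remove[of UNIV j]
        sum_distrib_left)
  also have "(\<Sum>k\<in>UNIV - {j}. u $ k) = (\<Sum>k\<in>UNIV. u $ k) - u $ j"
    by (simp add: sum_diff1)
  finally show ?thesis by (simp add: algebra_simps)
qed

lemma word_mean_count_starting_with_Suc:
  assumes "(\<Sum>j\<in>UNIV. \<alpha> $ j) = 1"
  shows "word_mean \<alpha> (Suc n) (\<lambda>w. real (count_starting_with j w))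
    = (1 - \<alpha> $ j) * word_mean \<alpha> n (\<lambda>w. real (count_starting_with j w))
      + \<alpha> $ j * (1 + (\<Sum>k\<in>UNIV. word_mean \<alpha> n (\<lambda>w. real (count_starting_with k w))))"
    (is "?L = (1 - _) * ?m j + _ * (1 + (\<Sum>k\<in>UNIV. ?m k))")
proof -
  have "word_mean \<alpha> n (\<lambda>w. real (Suc (phi w))) = 1 + (\<Sum>k\<in>UNIV. ?m k)"
    by (simp add: phi_eq_sum_count_starting_with word_mean_add word_mean_sum
        word_mean_1[OF assms])
  then have "?L = (\<Sum>x\<in>UNIV. \<alpha> $ x * (if j = x then 1 + (\<Sum>k\<in>UNIV. ?m k) else ?m j))"
    unfolding word_mean_Suc count_starting_with_Cons
    by (intro sum.cong) auto
  also have "\<dots> = \<alpha> $ j * (1 + (\<Sum>k\<in>UNIV. ?m k)) + (\<Sum>x\<in>UNIV - {j}. \<alpha> $ x) * ?m j"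
    by (simp add: sum.remove[of UNIV j] sum_distrib_right)
  also have "(\<Sum>x\<in>UNIV - {j}. \<alpha> $ x) = 1 - \<alpha> $ j"
    by (simp add: sum_diff1 assms)
  finally show ?thesis by simp
qed

lemma word_mean_count_starting_with:
  assumes "(\<Sum>j\<in>UNIV. \<alpha> $ j) = 1"
  shows "word_mean \<alpha> n (\<lambda>w. real (count_starting_with j w))
    = ((\<Sum>i<n. matrix_pow (letter_matrix \<alpha>) i) *v \<alpha>) $ j"
proof (induction n arbitrary: j)
  case 0
  then show ?case by simp
next
  case (Suc n)
  then show ?case
    unfolding word_mean_count_starting_with_Suc[OF assms] sum_matrix_pow_Suc
    by (simp add: matrix_vector_mult_add_rdistrib letter_matrix_mult_vector
        algebra_simps flip: matrix_vector_mul_assoc)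
qed

section \<open>Expectation over a random string\<close>

lemma length_random_string [simp]: "length (random_string s n \<omega>) = n"
  by (simp add: random_string_def)

text \<open>The letters are numbered from \<open>1\<close>, the entries of a list from \<open>0\<close>; hence the shift.\<close>
lemma random_string_eq_iff:
  "random_string s n \<omega> = w \<longleftrightarrow> length w = n \<and> (\<forall>i\<in>{1..n}. s i \<omega> = w ! (i - 1))"
proof -
  have "random_string s n \<omega> ! i = s (Suc i) \<omega>" if "i < n" for i
    unfolding random_string_def using that by (subst nth_map) (simp_all del: upt_Suc)
  then have "random_string s n \<omega> = w \<longleftrightarrow> length w = n \<and> (\<forall>i<n. s (Suc i) \<omega> = w ! i)"
    unfolding list_eq_iff_nth_eq by (metis length_random_string)
  also have "(\<forall>i<n. s (Suc i) \<omega> = w ! i) \<longleftrightarrow> (\<forall>i\<in>Suc ` {..<n}. s i \<omega> = w ! (i - 1))"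
    by (auto simp del: image_Suc_lessThan)
  finally show ?thesis
    by (simp only: image_Suc_lessThan)
qed

lemma prob_random_string_eq:
  fixes \<alpha> :: "real ^ 'd::finite"
  assumes "1 \<le> n" and "prob_space P"
    and indep: "prob_space.indep_vars P (\<lambda>_. count_space UNIV) s {1..n}"
    and dist: "\<And>i j. i \<in> {1..n} \<Longrightarrow> measure P {\<omega> \<in> space P. s i \<omega> = j} = \<alpha> $ j"
    and w: "length w = n"
  shows "{\<omega> \<in> space P. random_string s n \<omega> = w} \<in> sets P"
    and "measure P {\<omega> \<in> space P. random_string s n \<omega> = w} = prod_list (map (($) \<alpha>) w)"
proof -
  interpret prob_space P by fact
  let ?A = "\<lambda>i. s i -` {w ! (i - 1)} \<inter> space P"
  have event: "{\<omega> \<in> space P. random_string s n \<omega> = w} = (\<Inter>i\<in>{1..n}. ?A i)"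
    using \<open>1 \<le> n\<close> w by (auto simp: random_string_eq_iff)
  have "?A i \<in> sets P" if "i \<in> {1..n}" for i
  proof -
    have "s i \<in> measurable P (count_space UNIV)"
      using indep that unfolding indep_vars_def by blast
    from measurable_sets[OF this] show ?thesis
      by simp
  qed
  then show "{\<omega> \<in> space P. random_string s n \<omega> = w} \<in> sets P"
    unfolding event using \<open>1 \<le> n\<close> by (intro sets.finite_INT) auto
  have "prob (\<Inter>i\<in>{1..n}. ?A i) = (\<Prod>i\<in>{1..n}. prob (?A i))"
    using \<open>1 \<le> n\<close> by (intro indep_varsD[OF indep]) auto
  also have "\<dots> = (\<Prod>i\<in>{1..n}. \<alpha> $ (w ! (i - 1)))"
  proof (intro prod.cong refl)
    fix i assume "i \<in> {1..n}"
    moreover have "?A i = {\<omega> \<in> space P. s i \<omega> = w ! (i - 1)}" by auto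
    ultimately show "prob (?A i) = \<alpha> $ (w ! (i - 1))" by (simp add: dist)
  qed
  also have "\<dots> = (\<Prod>i<n. \<alpha> $ (w ! i))"
    using prod.atLeast1_atMost_eq[of "\<lambda>i. \<alpha> $ (w ! (i - 1))" n] by simp
  also have "\<dots> = prod_list (map (($) \<alpha>) w)"
    by (simp add: prod.list_conv_set_nth w lessThan_atLeast0)
  finally show "prob {\<omega> \<in> space P. random_string s n \<omega> = w} = prod_list (map (($) \<alpha>) w)"
    by (simp add: event)
qed

lemma expectation_random_string:
  fixes \<alpha> :: "real ^ 'd::finite" and f :: "'d list \<Rightarrow> real"
  assumes "1 \<le> n" and "prob_space P"
    and "prob_space.indep_vars P (\<lambda>_. count_space UNIV) s {1..n}"
    and "\<And>i j. i \<in> {1..n} \<Longrightarrow> measure P {\<omega> \<in> space P. s i \<omega> = j} = \<alpha> $ j"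
  shows "prob_space.expectation P (\<lambda>\<omega>. f (random_string s n \<omega>)) = word_mean \<alpha> n f"
proof -
  interpret prob_space P by fact
  let ?E = "\<lambda>w. {\<omega> \<in> space P. random_string s n \<omega> = w}"
  note event = prob_random_string_eq[OF assms]
  have "expectation (\<lambda>\<omega>. f (random_string s n \<omega>))
      = expectation (\<lambda>\<omega>. \<Sum>w | length w = n. f w * indicator (?E w) \<omega>)"
  proof (intro Bochner_Integration.integral_cong refl)
    fix \<omega> assume \<omega>: "\<omega> \<in> space P"
    have "(\<Sum>w | length w = n. f w * indicator (?E w) \<omega>)
        = (\<Sum>w | length w = n. if random_string s n \<omega> = w then f w else 0)"
      using \<omega> by (intro sum.cong) (auto simp: indicator_def)
    then show "f (random_string s n \<omega>) = (\<Sum>w | length w = n. f w * indicator (?E w) \<omega>)"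
      by (simp add: finite_words_length)
  qed
  also have "\<dots> = (\<Sum>w | length w = n. f w * prob (?E w))"
    using event(1) by (subst Bochner_Integration.integral_sum) (auto simp: less_top[symmetric])
  also have "\<dots> = word_mean \<alpha> n f"
    unfolding word_mean_def
  proof (intro sum.cong refl)
    fix w :: "'d list"
    assume "w \<in> {w. length w = n}"
    then have "prob (?E w) = prod_list (map (($) \<alpha>) w)"
      by (intro event(2)) auto
    then show "f w * prob (?E w) = prod_list (map (($) \<alpha>) w) * f w"
      by simp
  qed
  finally show ?thesis .
qed

theorem theorem3p5:
  fixes \<alpha> :: "real ^ 'd::finite" and n :: nat
    and P :: "'w measure" and s :: "nat \<Rightarrow> 'w \<Rightarrow> 'd"
  assumes "\<And>j. 0 \<le> \<alpha> $ j" and "(\<Sum>j\<in>UNIV. \<alpha> $ j) = 1"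
    and "1 \<le> n"
    and "prob_space P"
    and "prob_space.indep_vars P (\<lambda>_. count_space UNIV) s {1..n}"
    and "\<And>i j. i \<in> {1..n} \<Longrightarrow> measure P {\<omega> \<in> space P. s i \<omega> = j} = \<alpha> $ j"
  shows "prob_space.expectation P (\<lambda>\<omega>. real (phi (random_string s n \<omega>)))
    = ((\<chi> j. 1) v* (\<Sum>i=0..n-1. matrix_pow (letter_matrix \<alpha>) i)) \<bullet> \<alpha>"
proof -
  have range: "{0..n-1} = {..<n}"
    using \<open>1 \<le> n\<close> by auto
  have "prob_space.expectation P (\<lambda>\<omega>. real (phi (random_string s n \<omega>)))
      = word_mean \<alpha> n (\<lambda>w. real (phi w))"
    using expectation_random_string[OF assms(3-6), of "\<lambda>w. real (phi w)"] by simp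
  also have "\<dots> = (\<Sum>j\<in>UNIV. word_mean \<alpha> n (\<lambda>w. real (count_starting_with j w)))"
    by (simp add: phi_eq_sum_count_starting_with word_mean_sum)
  also have "\<dots> = (\<Sum>j\<in>UNIV. ((\<Sum>i<n. matrix_pow (letter_matrix \<alpha>) i) *v \<alpha>) $ j)"
    by (simp add: word_mean_count_starting_with[OF assms(2)])
  also have "\<dots> = (\<chi> j. 1) \<bullet> ((\<Sum>i<n. matrix_pow (letter_matrix \<alpha>) i) *v \<alpha>)"
    by (simp add: inner_vec_def)
  also have "\<dots> = ((\<chi> j. 1) v* (\<Sum>i=0..n-1. matrix_pow (letter_matrix \<alpha>) i)) \<bullet> \<alpha>"
    by (simp only: dot_lmul_matrix range)
  finally show ?thesis .
qed

end
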